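(* Assume that $\tilde B^{(1)}$ is of full rank and that $b_j(t;0)$ does not vanish for any $3\le j\le s$. If the equation $$q^{-\frac12\Lambda^{(1)}(g^{(1)}_1,g^{(1)}_2)}M^{(1)}_1*M^{(1)}_2=\sum_{3\le j\le s}c^{(1)}_j(q^{1/2})\,M^{(1)}_j$$ holds in $\mathcal T^{(1)}$ for some coefficients $c^{(1)}_j(t)\in\mathbb Z[t^{\pm1}][x_{n+1}^{\pm1},\dots,x_{m^{(1)}}^{\pm1}]$, then there exist unique vectors $u_j\in\mathbb N^n$ ($3\le j\le s$) such that $g^{(1)}_j=g^{(1)}_1+g^{(1)}_2+\tilde B^{(1)}u_j$, and we have $$q^{-\frac12\Lambda^{(2)}(g^{(2)}_1,g^{(2)}_2)}M^{(2)}_1*M^{(2)}_2=\sum_{3\le j\le s}c^{(2)}_j(q^{\delta/2})\,M^{(2)}_j,$$ such that the coefficients, in $\mathbb Z[t^{\pm1}][x_{n+1}^{\pm1},\dots,x_{m^{(2)}}^{\pm1}]$, are given by $$c^{(2)}_j(q^{\delta/2})=c^{(1)}_j(q^{\delta/2})\,x^{g^{(2)}_1+g^{(2)}_2+\tilde B^{(2)}u_j-g^{(2)}_j}.$$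
   Context: Let $n,m^{(1)},m^{(2)}$ be integers with $0<n\le m^{(1)},m^{(2)}$. For $i=1,2$ let $\tilde B^{(i)}$ be an integer $m^{(i)}\times n$ matrix and $\Lambda^{(i)}$ a skew-symmetric integer $m^{(i)}\times m^{(i)}$ matrix. The pairs $(\tilde B^{(i)},\Lambda^{(i)})$ are assumed weakly compatible: there is an integer $n\times n$ matrix $D^{(i)}$ with $\Lambda^{(i)}(-\tilde B^{(i)})=\begin{bmatrix}D^{(i)}\\0\end{bmatrix}$. Assume that $\tilde B^{(1)}$ and $\tilde B^{(2)}$ have a common principal part $B$ (upper $n\times n$ submatrix), and that $D^{(2)}=\delta D^{(1)}$ for some integer $\delta$. The quantum torus $\mathcal T^{(i)}=\mathbb Z[q^{\pm1/2}][x_1^{\pm1},\dots,x_{m^{(i)}}^{\pm1}]$ has its usual commutative product (denoted by juxtaposition) and the twisted product $x^g*x^h=q^{\frac12\Lambda^{(i)}(g,h)}x^{g+h}$, where $\Lambda^{(i)}(g,h)=g^T\Lambda^{(i)}h$. Put $m=\max(m^{(1)},m^{(2)})$. By adding zero entries, $\tilde B^{(1)},\tilde B^{(2)}$ are enlarged to $m\times n$ matrices and $\Lambda^{(2)}$ to an $m\times m$ matrix, and one has the enlarged quantum torus $\mathcal T=\mathbb Z[q^{\pm1/2}][x_1^{\pm1},\dots,x_m^{\pm1}]$, whose twisted product is determined by the enlarged $\Lambda^{(2)}$; Laurent polynomials in fewer of the variables $x_i$ are regarded as elements of it. Let $s\ge3$ be an integer. For $1\le j\le s$ let $g^{(i)}_j\in\mathbb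 Z^{m^{(i)}}$ ($i=1,2$) be vectors whose first $n$ coordinates agree, i.e. $\mathrm{pr}_n g^{(1)}_j=\mathrm{pr}_n g^{(2)}_j$, where $\mathrm{pr}_n$ is projection to the first $n$ coordinates. Let $F_j(t;y_1,\dots,y_n)=\sum_{v\in\mathbb N^n}b_j(t;v)y^v\in\mathbb Z[t^{\pm1}][y_1,\dots,y_n]$ be polynomials, with $b_j(t;v)\in\mathbb Z[t^{\pm1}]$. Define (with the usual product) $$M^{(1)}_j=x^{g^{(1)}_j}\sum_{v\in\mathbb N^n}b_j(q^{1/2};v)\,x^{\tilde B^{(1)}v}\in\mathcal T^{(1)},\qquad M^{(2)}_j=x^{g^{(2)}_j}\sum_{v\in\mathbb N^n}b_j(q^{\delta/2};v)\,x^{\tilde B^{(2)}v}\in\mathcal T^{(2)}.$$ For a coefficient $c(t)$, the notation $c(q^{1/2})$ or $c(q^{\delta/2})$ means that $t$ is replaced by $q^{1/2}$ or $q^{\delta/2}$ respectively.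
   Formalization: Added: x^0 occurs in each c_j^(1); each g_j^(1)+a (a an exponent of c_j^(1)) is an exponent of sum_k c_k^(1) b_k(0) x^{g_k^(1)}; B^(1)w=B^(2)w if x^{B^(1)w} occurs in a c_j^(1). Automatic for distinct g_j^(1) and nonzero c_j^(1) in Z[t^±1]. *)

theory Defs
  imports
    Complex_Main
    "HOL-Library.Poly_Mapping"
    "Jordan_Normal_Form.Matrix"
    "Jordan_Normal_Form.DL_Rank"
begin

(* The ring \<int>[t^{\<plusminus>1}] is the monoid algebra of the additive group int; the power t^k is
   Poly_Mapping.single k 1. The same type serves for \<int>[q^{\<plusminus>1/2}], whose generator is q^{1/2}. *)

type_synonym laurent = "int \<Rightarrow>\<^sub>0 int"

(* Laurent polynomials with coefficients in laurent in the variables x_1, x_2, ...; x_{i+1} has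
   index i. The torus in m variables consists of the elements whose exponents are supported on
   {..<m}, so the tori in different numbers of variables are nested, and the ring product of the
   type is the usual commutative product. *)

type_synonym xlaurent = "(nat \<Rightarrow>\<^sub>0 int) \<Rightarrow>\<^sub>0 laurent"

definition qhalf :: "int \<Rightarrow> laurent"  (* q^{k/2} *)
  where "qhalf k = Poly_Mapping.single k 1"

definition expo :: "int vec \<Rightarrow> (nat \<Rightarrow>\<^sub>0 int)"  (* pads a vector with zeros *)
  where "expo g = (\<Sum>i<dim_vec g. Poly_Mapping.single i (g $ i))"

definition xmon :: "int vec \<Rightarrow> xlaurent"  (* x^g *)
  where "xmon g = Poly_Mapping.single (expo g) 1"

definition scal :: "laurent \<Rightarrow> xlaurent"
  where "scal a = Poly_Mapping.single 0 a"

definition frozen_ring :: "nat \<Rightarrow> nat \<Rightarrow> xlaurent set"  (* \<int>[t^{\<plusminus>1}][x_{n+1}^{\<plusminus>1},...,x_m^{\<plusminus>1}] *)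
  where "frozen_ring n m = {c. \<forall>a\<in>Poly_Mapping.keys c. Poly_Mapping.keys a \<subseteq> {n..<m}}"

(* subst_t d c is c(q^{d/2}): the substitution of q^{d/2} for t. As t and q^{1/2} are both
   single 1 1, subst_t 1 is the identity. *)

definition subst_t :: "int \<Rightarrow> laurent \<Rightarrow> laurent"
  where "subst_t d c = (\<Sum>k\<in>Poly_Mapping.keys c. Poly_Mapping.single (d * k) (Poly_Mapping.lookup c k))"

definition subst_coeffs :: "int \<Rightarrow> xlaurent \<Rightarrow> xlaurent"
  where "subst_coeffs d c = Poly_Mapping.map (subst_t d) c"

definition skew_form :: "int mat \<Rightarrow> int vec \<Rightarrow> int vec \<Rightarrow> int"
  where "skew_form L g h = g \<bullet> (L *\<^sub>v h)"

(* The bilinear extension of x^g * x^h = q^{L(g,h)/2} x^{g+h}. *)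

definition twisted_mult :: "int mat \<Rightarrow> xlaurent \<Rightarrow> xlaurent \<Rightarrow> xlaurent"
  where "twisted_mult L P Q =
    (\<Sum>a\<in>Poly_Mapping.keys P. \<Sum>b\<in>Poly_Mapping.keys Q.
       Poly_Mapping.single (a + b)
         (qhalf (skew_form L (vec (dim_row L) (Poly_Mapping.lookup a)) (vec (dim_row L) (Poly_Mapping.lookup b)))
          * Poly_Mapping.lookup P a * Poly_Mapping.lookup Q b))"

definition enlarge :: "nat \<Rightarrow> int mat \<Rightarrow> int mat"
  where "enlarge m L = four_block_mat L
     (0\<^sub>m (dim_row L) (m - dim_col L))
     (0\<^sub>m (m - dim_row L) (dim_col L))
     (0\<^sub>m (m - dim_row L) (m - dim_col L))"

definition weakly_compatible :: "nat \<Rightarrow> nat \<Rightarrow> int mat \<Rightarrow> int mat \<Rightarrow> int mat \<Rightarrow> bool"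
  where "weakly_compatible n m B L D \<longleftrightarrow>
    B \<in> carrier_mat m n \<and> L \<in> carrier_mat m m \<and> transpose_mat L = - L \<and>
    D \<in> carrier_mat n n \<and> L * (- B) = D @\<^sub>r 0\<^sub>m (m - n) n"

definition full_rank :: "nat \<Rightarrow> nat \<Rightarrow> int mat \<Rightarrow> bool"  (* m x n matrices with n \<le> m *)
  where "full_rank m n B \<longleftrightarrow> vec_space.rank m (map_mat rat_of_int B) = n"

(* A polynomial F = \<Sum>v. b(t;v) y^v in \<int>[t^{\<plusminus>1}][y_1,...,y_n] is given by its finitely supported
   family b of coefficients, with v ranging over carrier_vec n. *)

definition F_element :: "int \<Rightarrow> int mat \<Rightarrow> int vec \<Rightarrow> (nat vec \<Rightarrow>\<^sub>0 laurent) \<Rightarrow> xlaurent"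
  where "F_element d B g b =
    xmon g * (\<Sum>v\<in>Poly_Mapping.keys b. scal (subst_t d (Poly_Mapping.lookup b v)) * xmon (B *\<^sub>v map_vec int v))"

(* The part of \<Sum>j. c_j M_j coming from the terms b_j(t;0) x^{g_j}. For full rank B these are the
   minimal terms for the order g \<le> g + B v, v >= 0. If the M_j are linearly dependent, they can
   cancel, and then an identity M_1 * M_2 = \<Sum>j. c_j M_j says nothing about the g_j involved. *)

definition leading_part ::
  "nat \<Rightarrow> nat \<Rightarrow> (nat \<Rightarrow> xlaurent) \<Rightarrow> (nat \<Rightarrow> int vec) \<Rightarrow> (nat \<Rightarrow> nat vec \<Rightarrow>\<^sub>0 laurent) \<Rightarrow> xlaurent"
  where "leading_part n s c g b =
    (\<Sum>j = 3..s. subst_coeffs 1 (c j) * (scal (subst_t 1 (Poly_Mapping.lookup (b j) (0\<^sub>v n))) * xmon (g j)))"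

end

(* Weak compatibility makes Lambda(g + B v, g' + B w) - Lambda(g, g') depend only on D, on the
   principal part of B and on the first n coordinates of g and g', linearly in D. Hence both twisted
   products come from one Laurent polynomial P(t; y): put t = q^{1/2}, y = x^{B1} in the first torus
   and t = q^{delta/2}, y = x^{B2} in the second one, and multiply by x^{g_1 + g_2}. As B1 is
   injective, the hypothesis is an identity for P itself, once all the monomials of the c_j x^{g_j}
   are known to lie in x^{g_1 + g_2} x^{B1 v} with v >= 0. A monomial outside this cone that is
   minimal for the order x <= x + B1 v would occur on the right-hand side with its coefficient in
   the leading part, which does not vanish. *)

theory Submission
  imports Defs
begin

section \<open>Changing exponents and coefficients\<close>

text \<open>One operation covers the substitution for t, the passage from y^v to x^(B v) and their
  combination, so that compatibility with sums and products is proved once. As \<open>f\<close> may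
  fail to be injective, coefficients whose exponents collide are added.\<close>

definition relabel :: "('b::zero \<Rightarrow> 'd::comm_monoid_add) \<Rightarrow> ('a \<Rightarrow> 'c) \<Rightarrow> ('a \<Rightarrow>\<^sub>0 'b) \<Rightarrow> ('c \<Rightarrow>\<^sub>0 'd)"
  where "relabel s f p = (\<Sum>a\<in>Poly_Mapping.keys p. Poly_Mapping.single (f a) (s (Poly_Mapping.lookup p a)))"

lemma sum_keys_superset:
  fixes h :: "'a \<Rightarrow> 'b::zero \<Rightarrow> 'c::comm_monoid_add"
  assumes "finite A" "Poly_Mapping.keys p \<subseteq> A" "\<And>a. h a 0 = 0"
  shows "(\<Sum>a\<in>Poly_Mapping.keys p. h a (Poly_Mapping.lookup p a)) = (\<Sum>a\<in>A. h a (Poly_Mapping.lookup p a))"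
  using assms by (intro sum.mono_neutral_left) (auto simp: in_keys_iff)

text \<open>Cancellation can make the support of \<open>p + q\<close> smaller than the union of the
  two supports. Since \<open>h a\<close> vanishes at 0, all three sums may run over that
  union.\<close>

lemma sum_keys_add:
  assumes h: "\<And>a. additive (h a)"
  shows "(\<Sum>a\<in>Poly_Mapping.keys (p + q). h a (Poly_Mapping.lookup (p + q) a))
    = (\<Sum>a\<in>Poly_Mapping.keys p. h a (Poly_Mapping.lookup p a))
      + (\<Sum>a\<in>Poly_Mapping.keys q. h a (Poly_Mapping.lookup q a))"
proof -
  let ?A = "Poly_Mapping.keys p \<union> Poly_Mapping.keys q"
  have 0: "h a 0 = 0" for a
    using additive.zero[OF h] .
  have "(\<Sum>a\<in>Poly_Mapping.keys r. h a (Poly_Mapping.lookup r a)) = (\<Sum>a\<in>?A. h a (Poly_Mapping.lookup r a))"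
    if "Poly_Mapping.keys r \<subseteq> ?A" for r
    using that by (intro sum_keys_superset) (auto simp: 0)
  from this[OF Poly_Mapping.keys_add] this[of p] this[of q] show ?thesis
    by (simp add: lookup_add additive.add[OF h] sum.distrib)
qed

lemma sum_keys_sum:
  assumes h: "\<And>a. additive (h a)"
  shows "(\<Sum>a\<in>Poly_Mapping.keys (sum P I). h a (Poly_Mapping.lookup (sum P I) a))
    = (\<Sum>i\<in>I. \<Sum>a\<in>Poly_Mapping.keys (P i). h a (Poly_Mapping.lookup (P i) a))"
  by (induction I rule: infinite_finite_induct) (simp_all add: sum_keys_add[OF h])

lemma sum_keys_single:
  assumes h: "\<And>a. additive (h a)"
  shows "(\<Sum>a\<in>Poly_Mapping.keys (Poly_Mapping.single k x). h a (Poly_Mapping.lookup (Poly_Mapping.single k x) a)) = h k x"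
  using additive.zero[OF h] by (cases "x = 0") auto

text \<open>Additivity of \<open>h\<close> in the coefficient makes collisions and cancellations
  under \<open>f\<close> harmless. This lets a sum over the support of an image be computed over the
  source without injectivity.\<close>

lemma sum_keys_relabel:
  assumes h: "\<And>a. additive (h a)"
  shows "(\<Sum>c\<in>Poly_Mapping.keys (relabel s f p). h c (Poly_Mapping.lookup (relabel s f p) c))
    = (\<Sum>a\<in>Poly_Mapping.keys p. h (f a) (s (Poly_Mapping.lookup p a)))"
  unfolding relabel_def sum_keys_sum[OF h] sum_keys_single[OF h] ..

lemma additive_single: "additive s \<Longrightarrow> additive (\<lambda>x. Poly_Mapping.single k (s x))"
  by (simp add: additive_def single_add)

lemma additive_id: "additive (\<lambda>x. x)"
  by (simp add: additive_def)

lemma additive_relabel: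
  assumes "additive s"
  shows "additive (relabel s f)"
  unfolding relabel_def
  by (rule additive.intro, rule sum_keys_add[OF additive_single[OF assms]])

lemma relabel_single [simp]:
  "s 0 = 0 \<Longrightarrow> relabel s f (Poly_Mapping.single k x) = Poly_Mapping.single (f k) (s x)"
  by (cases "x = 0") (auto simp: relabel_def)

lemma relabel_relabel:
  assumes "additive t"
  shows "relabel t g (relabel s f p) = relabel (\<lambda>x. t (s x)) (\<lambda>a. g (f a)) p"
  unfolding relabel_def[of t g] relabel_def[of "\<lambda>x. t (s x)"]
  by (rule sum_keys_relabel[OF additive_single[OF assms]])

lemma relabel_cong:
  assumes "\<And>a. a \<in> Poly_Mapping.keys p \<Longrightarrow> f a = g a" "\<And>x. s x = t x"
  shows "relabel s f p = relabel t g p"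
  using assms by (simp add: relabel_def)

lemma lookup_relabel_same:
  assumes "s 0 = 0" and "\<And>a. a \<in> Poly_Mapping.keys p \<Longrightarrow> f a = a"
  shows "Poly_Mapping.lookup (relabel s f p) k = s (Poly_Mapping.lookup p k)"
proof -
  have "Poly_Mapping.lookup (relabel s f p) k
      = (\<Sum>a\<in>Poly_Mapping.keys p. if a = k then s (Poly_Mapping.lookup p a) else 0)"
    unfolding relabel_def lookup_sum using assms(2) by (intro sum.cong) (auto simp: lookup_single when_def)
  also have "\<dots> = s (Poly_Mapping.lookup p k)"
    using assms(1) by (auto simp: in_keys_iff)
  finally show ?thesis .
qed

lemma relabel_same:
  assumes "\<And>a. a \<in> Poly_Mapping.keys p \<Longrightarrow> f a = a" "\<And>x. s x = x"
  shows "relabel s f p = p"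
  using assms by (intro poly_mapping_eqI) (simp add: lookup_relabel_same)

lemma sum_monomials: "p = (\<Sum>a\<in>Poly_Mapping.keys p. Poly_Mapping.single a (Poly_Mapping.lookup p a))"
  using relabel_same[of p id id] by (simp add: relabel_def)

text \<open>Additivity reduces the claim to products of two monomials, where it is multiplicativity
  of \<open>s\<close> and additivity of \<open>f\<close>.\<close>

lemma relabel_mult:
  fixes p q :: "'a::monoid_add \<Rightarrow>\<^sub>0 'b::ring" and s :: "'b \<Rightarrow> 'd::ring" and f :: "'a \<Rightarrow> 'c::monoid_add"
  assumes s: "additive s" and m: "\<And>x y. s (x * y) = s x * s y" and f: "\<And>a b. f (a + b) = f a + f b"
  shows "relabel s f (p * q) = relabel s f p * relabel s f q"
proof -
  have "relabel s f (p * q) = relabel s f (\<Sum>a\<in>Poly_Mapping.keys p. \<Sum>b\<in>Poly_Mapping.keys q.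
      Poly_Mapping.single (a + b) (Poly_Mapping.lookup p a * Poly_Mapping.lookup q b))"
    by (subst sum_monomials[of p], subst sum_monomials[of q])
      (simp add: sum_product mult_single)
  also have "\<dots> = relabel s f p * relabel s f q"
    by (simp add: additive.sum[OF additive_relabel[OF s]] additive.zero[OF s] m f)
      (simp add: relabel_def sum_product mult_single)
  finally show ?thesis .
qed

lemma keys_relabel: "Poly_Mapping.keys (relabel s f p) \<subseteq> f ` Poly_Mapping.keys p"
proof
  fix c assume "c \<in> Poly_Mapping.keys (relabel s f p)"
  then have "(\<Sum>a\<in>Poly_Mapping.keys p. Poly_Mapping.lookup (Poly_Mapping.single (f a) (s (Poly_Mapping.lookup p a))) c) \<noteq> 0"
    by (simp add: relabel_def in_keys_iff lookup_sum)
  then obtain a where "a \<in> Poly_Mapping.keys p"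
      "Poly_Mapping.lookup (Poly_Mapping.single (f a) (s (Poly_Mapping.lookup p a))) c \<noteq> 0"
    by (rule sum.not_neutral_contains_not_neutral)
  then show "c \<in> f ` Poly_Mapping.keys p"
    by (auto simp: lookup_single when_def split: if_splits)
qed

section \<open>Substituting a power of q^(1/2) for t\<close>

lemma subst_t_relabel: "subst_t d = relabel (\<lambda>x. x) ((*) d)"
  by (simp add: fun_eq_iff subst_t_def relabel_def)

lemma additive_subst_t: "additive (subst_t d)"
  unfolding subst_t_relabel by (intro additive_relabel additive_id)

text \<open>The map k to d k on exponents is additive for every integer d, including d = 0, where it
  is not injective.\<close>

lemma subst_t_mult: "subst_t d (x * y) = subst_t d x * subst_t d y"
  unfolding subst_t_relabel by (intro relabel_mult additive_id) (simp_all add: algebra_simps)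

lemma subst_t_1_left [simp]: "subst_t 1 x = x"
  unfolding subst_t_relabel by (intro relabel_same) simp_all

lemma subst_t_0 [simp]: "subst_t d 0 = 0"
  using additive.zero[OF additive_subst_t] .

lemma subst_t_qhalf: "subst_t d (qhalf k) = qhalf (d * k)"
  by (simp add: subst_t_relabel qhalf_def)

lemma qhalf_add: "qhalf (k + l) = qhalf k * qhalf l"
  by (simp add: qhalf_def mult_single)

lemma qhalf_0 [simp]: "qhalf 0 = 1"
  by (simp add: qhalf_def)

lemma subst_t_1 [simp]: "subst_t d 1 = 1"
  using subst_t_qhalf[of d 0] by simp

lemma subst_coeffs_relabel: "subst_coeffs d = relabel (subst_t d) (\<lambda>a. a)"
proof
  fix c
  \<comment> \<open>\<open>Poly_Mapping.map\<close> leaves absent coefficients at 0, which agrees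
    with \<open>relabel\<close> because \<open>subst_t d\<close> maps 0 to 0.\<close>
  show "subst_coeffs d c = relabel (subst_t d) (\<lambda>a. a) c"
    by (intro poly_mapping_eqI) (simp add: subst_coeffs_def lookup_relabel_same Poly_Mapping.map.rep_eq when_def)
qed

lemma subst_coeffs_mult: "subst_coeffs d (p * q) = subst_coeffs d p * subst_coeffs d q"
  unfolding subst_coeffs_relabel by (intro relabel_mult additive_subst_t subst_t_mult) simp

lemma subst_coeffs_xmon [simp]: "subst_coeffs d (xmon g) = xmon g"
  by (simp add: subst_coeffs_relabel xmon_def)

lemma subst_coeffs_1 [simp]: "subst_coeffs 1 p = p"
  unfolding subst_coeffs_relabel by (intro relabel_same) simp_all

section \<open>Monomials and linear maps of exponents\<close>

lemma lookup_expo: "Poly_Mapping.lookup (expo g) i = (if i < dim_vec g then g $ i else 0)"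
  by (simp add: expo_def lookup_sum lookup_single when_def)

lemma vec_lookup_expo: "g \<in> carrier_vec m \<Longrightarrow> vec m (Poly_Mapping.lookup (expo g)) = g"
  by (intro eq_vecI) (auto simp: lookup_expo)

lemma expo_inject: "g \<in> carrier_vec m \<Longrightarrow> h \<in> carrier_vec m \<Longrightarrow> expo g = expo h \<longleftrightarrow> g = h"
  by (metis vec_lookup_expo)

lemma expo_add: "g \<in> carrier_vec m \<Longrightarrow> h \<in> carrier_vec m \<Longrightarrow> expo (g + h) = expo g + expo h"
  by (intro poly_mapping_eqI) (auto simp: lookup_expo lookup_add)

lemma expo_diff: "g \<in> carrier_vec m \<Longrightarrow> h \<in> carrier_vec m \<Longrightarrow> expo (g - h) = expo g - expo h"
  by (intro poly_mapping_eqI) (auto simp: lookup_expo lookup_minus)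

lemma xmon_add: "g \<in> carrier_vec m \<Longrightarrow> h \<in> carrier_vec m \<Longrightarrow> xmon (g + h) = xmon g * xmon h"
  by (simp add: xmon_def expo_add mult_single)

text \<open>x^g is a unit, with inverse x^(-g).\<close>

lemma xmon_cancel: "xmon g * p = xmon g * q \<longleftrightarrow> p = q"
proof
  assume "xmon g * p = xmon g * q"
  then have "Poly_Mapping.single (- expo g) 1 * (xmon g * p) = Poly_Mapping.single (- expo g) 1 * (xmon g * q)"
    by simp
  then show "p = q"
    by (simp add: mult.assoc[symmetric] xmon_def mult_single)
qed simp

text \<open>Coordinates from n on are ignored instead of excluded. The map is thereby total and
  additive on all exponents, as \<open>relabel_mult\<close> demands.\<close>

definition lattice_map :: "nat \<Rightarrow> int mat \<Rightarrow> (nat \<Rightarrow>\<^sub>0 int) \<Rightarrow> (nat \<Rightarrow>\<^sub>0 int)"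
  where "lattice_map n B w = expo (B *\<^sub>v vec n (Poly_Mapping.lookup w))"

lemma lattice_map_expo: "v \<in> carrier_vec n \<Longrightarrow> lattice_map n B (expo v) = expo (B *\<^sub>v v)"
  by (simp add: lattice_map_def vec_lookup_expo)

lemma lattice_map_add:
  assumes "B \<in> carrier_mat m n"
  shows "lattice_map n B (v + w) = lattice_map n B v + lattice_map n B w"
proof -
  have "vec n (Poly_Mapping.lookup (v + w)) = vec n (Poly_Mapping.lookup v) + vec n (Poly_Mapping.lookup w)"
    by (auto simp: lookup_add)
  moreover have "B *\<^sub>v (vec n (Poly_Mapping.lookup v) + vec n (Poly_Mapping.lookup w))
      = B *\<^sub>v vec n (Poly_Mapping.lookup v) + B *\<^sub>v vec n (Poly_Mapping.lookup w)"
    using assms by (intro mult_add_distrib_mat_vec) auto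
  ultimately show ?thesis
    using assms by (auto simp: lattice_map_def intro!: expo_add[of _ m])
qed

lemma relabel_lattice_map_mult:
  assumes "B \<in> carrier_mat m n"
  shows "relabel (subst_t d) (lattice_map n B) (p * q)
    = relabel (subst_t d) (lattice_map n B) p * relabel (subst_t d) (lattice_map n B) q"
  by (intro relabel_mult additive_subst_t subst_t_mult lattice_map_add[OF assms])

lemma F_element_relabel:
  "F_element d B g b = xmon g * relabel (subst_t d) (\<lambda>v. expo (B *\<^sub>v map_vec int v)) b"
  by (simp add: F_element_def relabel_def scal_def xmon_def mult_single)

lemma F_element_relabel_shifted:
  "F_element d B g b = relabel (subst_t d) (\<lambda>v. expo g + expo (B *\<^sub>v map_vec int v)) b"
  by (simp add: F_element_def relabel_def scal_def xmon_def mult_single sum_distrib_left)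

text \<open>Rank n makes the n columns linearly independent over the rationals, so no nonzero
  difference v - w lies in the kernel. The library treats the columns as a set, hence their
  distinctness has to be shown first.\<close>

lemma full_rank_injective:
  assumes B: "B \<in> carrier_mat m n" and r: "full_rank m n B"
    and v: "v \<in> carrier_vec n" "w \<in> carrier_vec n" and e: "B *\<^sub>v v = B *\<^sub>v w"
  shows "v = w"
proof (rule ccontr)
  assume ne: "v \<noteq> w"
  interpret vec_space "TYPE(rat)" m .
  let ?B = "map_mat rat_of_int B" and ?x = "map_vec rat_of_int (v - w)"
  have Bc: "?B \<in> carrier_mat m n" and x: "?x \<in> carrier_vec n"
    using B v by auto
  have rk: "rank ?B = n"
    using r by (simp add: full_rank_def)
  have "v - w \<noteq> 0\<^sub>v n"
    using v ne by (metis carrier_vecD eq_iff_diff_eq_0 eq_vecI index_minus_vec(1) index_zero_vec(1))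
  then have x0: "?x \<noteq> 0\<^sub>v n"
    by simp
  have "?B *\<^sub>v ?x = map_vec rat_of_int (B *\<^sub>v (v - w))"
    using B v by (intro of_int_hom.mult_mat_vec_hom[symmetric]) auto
  also have "B *\<^sub>v (v - w) = 0\<^sub>v m"
    using B v e by (simp add: mult_minus_distrib_mat_vec) 
  finally have z: "?B *\<^sub>v ?x = 0\<^sub>v m"
    by simp
  \<comment> \<open>A maximal independent set of columns has as many elements as the rank, namely n.
    So the list of n columns has at least n different entries and contains no repetition.\<close>
  obtain S where S: "maximal S (\<lambda>T. T \<subseteq> set (cols ?B) \<and> lin_indpt T)"
    using maximal_exists_superset[of "set (cols ?B)" "\<lambda>T. T \<subseteq> set (cols ?B) \<and> lin_indpt T" "{}"]
    by (auto simp: finite_lin_indpt2)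
  have "card S \<le> card (set (cols ?B))"
    using S by (intro card_mono) (auto simp: maximal_def)
  moreover have "card S = n"
    using rank_card_indpt[OF Bc S] rk by simp
  ultimately have d: "distinct (cols ?B)"
    using B card_length[of "cols ?B"] by (intro card_distinct) auto
  show False
    using lin_depI[OF Bc x x0 z d] full_rank_lin_indpt[OF Bc rk d] by blast
qed

section \<open>The twisted product\<close>

lemma skew_form_sum:
  assumes "L \<in> carrier_mat m m" "g \<in> carrier_vec m" "h \<in> carrier_vec m"
  shows "skew_form L g h = (\<Sum>i<m. \<Sum>j<m. g $ i * (L $$ (i, j) * h $ j))"
  using assms by (auto simp: skew_form_def scalar_prod_def sum_distrib_left lessThan_atLeast0 intro!: sum.cong)

lemma enlarge_carrier: "L \<in> carrier_mat m m \<Longrightarrow> m \<le> M \<Longrightarrow> enlarge M L \<in> carrier_mat M M"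
  by (auto simp: enlarge_def)

lemma enlarge_same: "L \<in> carrier_mat m m \<Longrightarrow> enlarge m L = L"
  by (intro eq_matI) (auto simp: enlarge_def)

text \<open>Padding adds only zero summands, so exponents of the smaller torus keep their power of q
  in the enlarged one.\<close>

lemma skew_form_enlarge:
  assumes L: "L \<in> carrier_mat m m" and M: "m \<le> M" and g: "g \<in> carrier_vec m" and h: "h \<in> carrier_vec m"
  shows "skew_form (enlarge M L) (vec M (Poly_Mapping.lookup (expo g))) (vec M (Poly_Mapping.lookup (expo h)))
    = skew_form L g h"
proof -
  have "skew_form (enlarge M L) (vec M (Poly_Mapping.lookup (expo g))) (vec M (Poly_Mapping.lookup (expo h)))
      = (\<Sum>i<M. \<Sum>j<M. (if i < m then g $ i else 0) * (enlarge M L $$ (i, j) * (if j < m then h $ j else 0)))"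
    using g h by (subst skew_form_sum[OF enlarge_carrier[OF L M]])
      (auto simp: lookup_expo intro!: sum.cong)
  also have "\<dots> = (\<Sum>i<m. \<Sum>j<M. g $ i * (enlarge M L $$ (i, j) * (if j < m then h $ j else 0)))"
    using M by (intro sum.mono_neutral_cong_right) auto
  also have "\<dots> = (\<Sum>i<m. \<Sum>j<m. g $ i * (L $$ (i, j) * h $ j))"
    using M L by (intro sum.cong[OF refl] sum.mono_neutral_cong_right) (auto simp: enlarge_def)
  also have "\<dots> = skew_form L g h"
    using skew_form_sum[OF L g h] by simp
  finally show ?thesis .
qed

lemma skew_form_add:
  assumes L: "L \<in> carrier_mat m m" and "g \<in> carrier_vec m" "g' \<in> carrier_vec m" "h \<in> carrier_vec m" "h' \<in> carrier_vec m"
  shows "skew_form L (g + g') (h + h') = skew_form L g h + skew_form L g h' + skew_form L g' h + skew_form L g' h'"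
  using assms
  by (simp add: skew_form_def mult_add_distrib_mat_vec[OF L] add_scalar_prod_distrib[of _ m] scalar_prod_add_distrib[of _ m])

lemma skew_form_commute:
  assumes L: "L \<in> carrier_mat m m" and t: "transpose_mat L = - L" and g: "g \<in> carrier_vec m" and h: "h \<in> carrier_vec m"
  shows "skew_form L g h = - skew_form L h g"
proof -
  have "g $ i * (L $$ (i, j) * h $ j) = - (h $ j * (L $$ (j, i) * g $ i))" if "i < m" "j < m" for i j
  proof -
    have "L $$ (j, i) = - L $$ (i, j)"
      using arg_cong[OF t, of "\<lambda>A. A $$ (i, j)"] that L by auto
    then show ?thesis
      by (simp add: mult_ac)
  qed
  then have "(\<Sum>i<m. \<Sum>j<m. g $ i * (L $$ (i, j) * h $ j)) = (\<Sum>i<m. \<Sum>j<m. - (h $ j * (L $$ (j, i) * g $ i)))"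
    by (intro sum.cong refl) (simp only: lessThan_iff)
  also have "\<dots> = - (\<Sum>j<m. \<Sum>i<m. h $ j * (L $$ (j, i) * g $ i))"
    by (subst sum.swap) (simp add: sum_negf)
  finally show ?thesis
    by (simp add: skew_form_sum[OF L g h] skew_form_sum[OF L h g])
qed

text \<open>The zero block below \<open>D\<close> removes the coordinates of \<open>g\<close> from n
  on. The sign comes from the convention L (-B) = [D; 0].\<close>

lemma skew_form_weakly_compatible:
  assumes w: "weakly_compatible n m B L D" and n: "n \<le> m" and g: "g \<in> carrier_vec m" and v: "v \<in> carrier_vec n"
  shows "skew_form L g (B *\<^sub>v v) = - (vec_first g n \<bullet> (D *\<^sub>v v))"
proof -
  have B: "B \<in> carrier_mat m n" and L: "L \<in> carrier_mat m m" and D: "D \<in> carrier_mat n n"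
    and LB: "L * (- B) = D @\<^sub>r 0\<^sub>m (m - n) n"
    using w by (auto simp: weakly_compatible_def)
  have LBv: "L *\<^sub>v (B *\<^sub>v v) = - ((D @\<^sub>r 0\<^sub>m (m - n) n) *\<^sub>v v)"
    using B L v by (simp add: LB[symmetric])
  have row: "row (D @\<^sub>r 0\<^sub>m (m - n) n) i = (if i < n then row D i else 0\<^sub>v n)" if "i < m" for i
    using that D n by (auto simp: append_rows_def intro!: eq_vecI)
  have "skew_form L g (B *\<^sub>v v) = (\<Sum>i<m. g $ i * - (row (D @\<^sub>r 0\<^sub>m (m - n) n) i \<bullet> v))"
    using D n by (auto simp: skew_form_def LBv scalar_prod_def[of g] append_rows_def lessThan_atLeast0 intro!: sum.cong)
  also have "\<dots> = (\<Sum>i<n. - (g $ i * (row D i \<bullet> v)))"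
    using n v by (intro sum.mono_neutral_cong_right) (auto simp: row)
  also have "\<dots> = - (vec_first g n \<bullet> (D *\<^sub>v v))"
    using D by (simp add: vec_first_def scalar_prod_def[of "vec n (($) g)"] sum_negf lessThan_atLeast0)
  finally show ?thesis .
qed

section \<open>The exponent of q produced by the twist\<close>

definition principal_part :: "nat \<Rightarrow> int mat \<Rightarrow> int mat"
  where "principal_part n B = mat n n (\<lambda>ik. B $$ ik)"

lemma vec_first_mult_mat_vec:
  assumes "B \<in> carrier_mat m n" "n \<le> m" "v \<in> carrier_vec n"
  shows "vec_first (B *\<^sub>v v) n = principal_part n B *\<^sub>v v"
  using assms by (intro eq_vecI) (auto simp: vec_first_def principal_part_def scalar_prod_def)

text \<open>The three terms stem, in this order, from L(B v, g'), L(g, B w) and L(B v, B w), where h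
  and h' are the first n coordinates of g and g' and A is the principal part of B.\<close>

definition twist_exponent :: "int mat \<Rightarrow> int mat \<Rightarrow> int vec \<Rightarrow> int vec \<Rightarrow> int vec \<Rightarrow> int vec \<Rightarrow> int"
  where "twist_exponent D A h h' v w = h' \<bullet> (D *\<^sub>v v) - h \<bullet> (D *\<^sub>v w) - (A *\<^sub>v v) \<bullet> (D *\<^sub>v w)"

text \<open>Writing the compatibility matrix as d D with the same D for both tori isolates the
  factor d by which their twists differ.\<close>

lemma skew_form_twist:
  assumes w: "weakly_compatible n m B L (d \<cdot>\<^sub>m D)" and n: "n \<le> m"
    and g: "g \<in> carrier_vec m" "g' \<in> carrier_vec m" and v: "v \<in> carrier_vec n" "v' \<in> carrier_vec n"
  shows "skew_form L (g + B *\<^sub>v v) (g' + B *\<^sub>v v')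
    = skew_form L g g' + d * twist_exponent D (principal_part n B) (vec_first g n) (vec_first g' n) v v'"
proof -
  have B: "B \<in> carrier_mat m n" and L: "L \<in> carrier_mat m m" and dD: "d \<cdot>\<^sub>m D \<in> carrier_mat n n"
    and t: "transpose_mat L = - L"
    using w by (auto simp: weakly_compatible_def)
  have D: "D \<in> carrier_mat n n"
    using carrier_matD[OF dD] by (intro carrier_matI) simp_all
  note Bv = mult_mat_vec_carrier[OF B v(1)] mult_mat_vec_carrier[OF B v(2)]
  have sc: "x \<bullet> (d \<cdot>\<^sub>m D *\<^sub>v y) = d * (x \<bullet> (D *\<^sub>v y))" if "y \<in> carrier_vec n" for x y
    using D that by (auto simp: scalar_prod_def sum_distrib_left intro!: sum.cong)
  show ?thesis
    \<comment> \<open>Weak compatibility evaluates the form only with B v in the second argument;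
      skew-symmetry brings L(B v, g') into that shape.\<close>
    using skew_form_commute[OF L t Bv(1) g(2)]
    by (simp add: skew_form_add[OF L g(1) Bv(1) g(2) Bv(2)] skew_form_weakly_compatible[OF w n _ v(1)] g Bv
        skew_form_weakly_compatible[OF w n _ v(2)] vec_first_mult_mat_vec[OF B n v(1)] sc v
        twist_exponent_def algebra_simps)
qed

text \<open>The twisted product is additive in each coefficient separately, so both sums can be
  pulled back along \<open>sum_keys_relabel\<close>, one after the other.\<close>

lemma twisted_mult_relabel:
  assumes s: "additive s" and t: "additive t"
  shows "twisted_mult L (relabel s f p) (relabel t f' q) =
    (\<Sum>a\<in>Poly_Mapping.keys p. \<Sum>b\<in>Poly_Mapping.keys q.
       Poly_Mapping.single (f a + f' b)
         (qhalf (skew_form L (vec (dim_row L) (Poly_Mapping.lookup (f a))) (vec (dim_row L) (Poly_Mapping.lookup (f' b))))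
          * s (Poly_Mapping.lookup p a) * t (Poly_Mapping.lookup q b)))"
proof -
  let ?q = "\<lambda>a b. qhalf (skew_form L (vec (dim_row L) (Poly_Mapping.lookup a)) (vec (dim_row L) (Poly_Mapping.lookup b)))"
  have 1: "additive (\<lambda>y. Poly_Mapping.single (a + c) (?q a c * x * y))" for a c x
    by (simp add: additive_def single_add[symmetric] distrib_left)
  have 2: "additive (\<lambda>x. \<Sum>b\<in>Poly_Mapping.keys q. Poly_Mapping.single (a + f' b) (?q a (f' b) * x * t (Poly_Mapping.lookup q b)))" for a
    by (simp add: additive_def single_add[symmetric] distrib_left distrib_right sum.distrib[symmetric])
  show ?thesis
    unfolding twisted_mult_def sum_keys_relabel[OF 1] sum_keys_relabel[OF 2] ..
qed

text \<open>The common source \<open>P(t; y)\<close> of both twisted products; as in \<^typ>\<open>xlaurent\<close>, the variable \<open>y\<^sub>i\<^sub>+\<^sub>1\<close> has index \<open>i\<close>.\<close>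

definition y_product :: "int mat \<Rightarrow> int mat \<Rightarrow> int vec \<Rightarrow> int vec
    \<Rightarrow> (nat vec \<Rightarrow>\<^sub>0 laurent) \<Rightarrow> (nat vec \<Rightarrow>\<^sub>0 laurent) \<Rightarrow> xlaurent"
  where "y_product D A h h' b b' = (\<Sum>v\<in>Poly_Mapping.keys b. \<Sum>w\<in>Poly_Mapping.keys b'.
    Poly_Mapping.single (expo (map_vec int v) + expo (map_vec int w))
      (qhalf (twist_exponent D A h h' (map_vec int v) (map_vec int w))
        * Poly_Mapping.lookup b v * Poly_Mapping.lookup b' w))"

text \<open>Only exponents in N^n occur; this is what later places the left-hand side of the
  hypothesis in a cone.\<close>

lemma keys_y_product:
  assumes "Poly_Mapping.keys b \<subseteq> carrier_vec n" "Poly_Mapping.keys b' \<subseteq> carrier_vec n"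
  shows "Poly_Mapping.keys (y_product D A h h' b b') \<subseteq> (\<lambda>v. expo (map_vec int v)) ` carrier_vec n"
proof -
  have "Poly_Mapping.keys (y_product D A h h' b b') \<subseteq>
      (\<Union>v\<in>Poly_Mapping.keys b. \<Union>w\<in>Poly_Mapping.keys b'. {expo (map_vec int v) + expo (map_vec int w)})"
    unfolding y_product_def
    by (intro order_trans[OF keys_sum] UN_mono order_refl) simp
  also have "\<dots> \<subseteq> (\<lambda>v. expo (map_vec int v)) ` carrier_vec n"
  proof clarify
    fix v w assume "v \<in> Poly_Mapping.keys b" "w \<in> Poly_Mapping.keys b'"
    then have vw: "v \<in> carrier_vec n" "w \<in> carrier_vec n"
      using assms by auto
    then have "map_vec int (v + w) = map_vec int v + map_vec int w"
      by auto
    then have "expo (map_vec int v) + expo (map_vec int w) = expo (map_vec int (v + w))"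
      using vw by (simp add: expo_add[of _ n])
    then show "expo (map_vec int v) + expo (map_vec int w) \<in> (\<lambda>v. expo (map_vec int v)) ` carrier_vec n"
      using vw by auto
  qed
  finally show ?thesis .
qed

text \<open>The prefactor cancels L(g, g'), and the remaining power q^(d k/2), with k the twist
  exponent, is \<open>subst_t d\<close> of q^(k/2). As \<open>subst_t d\<close> is a ring
  homomorphism, the whole sum is an image of \<open>y_product\<close>. The bound M covers both the
  first torus (M = m) and the enlarged one.\<close>

lemma twisted_mult_F_element:
  assumes w: "weakly_compatible n m B L (d \<cdot>\<^sub>m D)" and n: "n \<le> m" and M: "m \<le> M"
    and g: "g \<in> carrier_vec m" "g' \<in> carrier_vec m"
    and b: "Poly_Mapping.keys b \<subseteq> carrier_vec n" "Poly_Mapping.keys b' \<subseteq> carrier_vec n"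
  shows "scal (qhalf (- skew_form L g g')) * twisted_mult (enlarge M L) (F_element d B g b) (F_element d B g' b')
    = xmon (g + g') * relabel (subst_t d) (lattice_map n B)
        (y_product D (principal_part n B) (vec_first g n) (vec_first g' n) b b')"
proof -
  have B: "B \<in> carrier_mat m n" and L: "L \<in> carrier_mat m m"
    using w by (auto simp: weakly_compatible_def)
  have dim: "dim_row (enlarge M L) = M"
    using enlarge_carrier[OF L M] by simp
  let ?q = "\<lambda>v w. twist_exponent D (principal_part n B) (vec_first g n) (vec_first g' n) (map_vec int v) (map_vec int w)"
  let ?e = "\<lambda>g v. expo g + expo (B *\<^sub>v map_vec int v)"
  have summand: "scal (qhalf (- skew_form L g g')) * Poly_Mapping.single (?e g v + ?e g' w)
        (qhalf (skew_form (enlarge M L) (vec M (Poly_Mapping.lookup (?e g v))) (vec M (Poly_Mapping.lookup (?e g' w)))) * x * y)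
      = xmon (g + g') * Poly_Mapping.single (lattice_map n B (expo (map_vec int v) + expo (map_vec int w)))
          (subst_t d (qhalf (?q v w)) * x * y)"
    if "v \<in> Poly_Mapping.keys b" "w \<in> Poly_Mapping.keys b'" for v w x y
  proof -
    have v: "map_vec int v \<in> carrier_vec n" "map_vec int w \<in> carrier_vec n"
      using that b by auto
    note Bv = mult_mat_vec_carrier[OF B v(1)] mult_mat_vec_carrier[OF B v(2)]
    have "skew_form (enlarge M L) (vec M (Poly_Mapping.lookup (?e g v))) (vec M (Poly_Mapping.lookup (?e g' w)))
        = skew_form L g g' + d * ?q v w"
      using skew_form_enlarge[OF L M, of "g + B *\<^sub>v map_vec int v" "g' + B *\<^sub>v map_vec int w"]
      by (simp add: expo_add[of _ m] g Bv skew_form_twist[OF w n g v])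
    moreover have cancel: "qhalf (- k) * (qhalf (k + l) * x * y) = qhalf l * x * y" for k l
      by (simp add: mult.assoc[symmetric] qhalf_add[symmetric])
    ultimately show ?thesis
      by (simp add: scal_def xmon_def mult_single subst_t_qhalf expo_add[OF g] lattice_map_add[OF B]
          lattice_map_expo[OF v(1)] lattice_map_expo[OF v(2)] cancel add_ac)
  qed
  have "scal (qhalf (- skew_form L g g')) * twisted_mult (enlarge M L) (F_element d B g b) (F_element d B g' b')
    = xmon (g + g') * (\<Sum>v\<in>Poly_Mapping.keys b. \<Sum>w\<in>Poly_Mapping.keys b'.
        Poly_Mapping.single (lattice_map n B (expo (map_vec int v) + expo (map_vec int w)))
          (subst_t d (qhalf (?q v w)) * subst_t d (Poly_Mapping.lookup b v) * subst_t d (Poly_Mapping.lookup b' w)))"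
    unfolding F_element_relabel_shifted twisted_mult_relabel[OF additive_subst_t additive_subst_t] sum_distrib_left dim
    by (intro sum.cong[OF refl] summand)
  also have "\<dots> = xmon (g + g') * relabel (subst_t d) (lattice_map n B)
        (y_product D (principal_part n B) (vec_first g n) (vec_first g' n) b b')"
    by (simp add: y_product_def additive.sum[OF additive_relabel[OF additive_subst_t]] subst_t_mult)
  finally show ?thesis .
qed

text \<open>Passing through polynomials in y places both sides of the identity in one ring, on which
  the relabelling by \<open>lattice_map\<close> is multiplicative.\<close>

lemma F_element_lattice_map:
  assumes "Poly_Mapping.keys b \<subseteq> carrier_vec n"
  shows "F_element d B g b = xmon g * relabel (subst_t d) (lattice_map n B)
    (relabel (\<lambda>x. x) (\<lambda>v. expo (map_vec int v)) b)"
proof -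
  have "lattice_map n B (expo (map_vec int v)) = expo (B *\<^sub>v map_vec int v)" if "v \<in> Poly_Mapping.keys b" for v
    using that assms by (intro lattice_map_expo) auto
  then have "relabel (subst_t d) (lattice_map n B) (relabel (\<lambda>x. x) (\<lambda>v. expo (map_vec int v)) b)
      = relabel (subst_t d) (\<lambda>v. expo (B *\<^sub>v map_vec int v)) b"
    unfolding relabel_relabel[OF additive_subst_t] by (rule relabel_cong) simp_all
  then show ?thesis
    by (simp only: F_element_relabel)
qed

section \<open>Injectivity on integer and natural exponents\<close>

lemma inj_on_lattice_map:
  assumes B: "B \<in> carrier_mat m n" and r: "full_rank m n B"
  shows "inj_on (lattice_map n B) (expo ` carrier_vec n)"
proof (rule inj_onI, clarify)
  fix v w :: "int vec" assume v: "v \<in> carrier_vec n" "w \<in> carrier_vec n"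
    and e: "lattice_map n B (expo v) = lattice_map n B (expo w)"
  then have "expo (B *\<^sub>v v) = expo (B *\<^sub>v w)"
    by (simp add: lattice_map_expo)
  then have "B *\<^sub>v v = B *\<^sub>v w"
    using B v by (subst (asm) expo_inject[of _ m]) auto
  then show "expo v = expo w"
    using full_rank_injective[OF B r v] by simp
qed

lemma map_vec_int_inject: "map_vec int v = map_vec int w \<Longrightarrow> v = w"
  by (metis (no_types, lifting) eq_vecI index_map_vec of_nat_eq_iff)

lemma expo_mult_mat_vec_injective:
  assumes B: "B \<in> carrier_mat m n" and r: "full_rank m n B"
    and v: "v \<in> carrier_vec n" "w \<in> carrier_vec n"
    and e: "expo (B *\<^sub>v map_vec int v) = expo (B *\<^sub>v map_vec int w)"
  shows "v = w"
proof -
  have "B *\<^sub>v map_vec int x \<in> carrier_vec m" for x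
    using B by (intro carrier_vecI) auto
  then have "B *\<^sub>v map_vec int v = B *\<^sub>v map_vec int w"
    using e by (simp add: expo_inject[of _ m])
  then have "map_vec int v = map_vec int w"
    using full_rank_injective[OF B r, of "map_vec int v" "map_vec int w"] v by simp
  then show ?thesis
    by (rule map_vec_int_inject)
qed

section \<open>Exponents occurring in the expansion\<close>

lemma keys_mult_subset:
  assumes "Poly_Mapping.keys p \<subseteq> S" "Poly_Mapping.keys q \<subseteq> T"
    and "\<And>a b. a \<in> S \<Longrightarrow> b \<in> T \<Longrightarrow> a + b \<in> U"
  shows "Poly_Mapping.keys (p * q) \<subseteq> U"
  using keys_mult[of p q] assms by blast

lemma keys_sum_subset:
  "(\<And>i. i \<in> I \<Longrightarrow> Poly_Mapping.keys (p i) \<subseteq> U) \<Longrightarrow> Poly_Mapping.keys (sum p I) \<subseteq> U"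
  by (induction I rule: infinite_finite_induct)
    (auto dest!: subsetD[OF Poly_Mapping.keys_add])

text \<open>This separates the minimal monomial from the strictly larger ones.\<close>

lemma F_element_split:
  assumes b: "Poly_Mapping.keys b \<subseteq> carrier_vec n"
  shows "\<exists>R. F_element 1 B g b = scal (Poly_Mapping.lookup b (0\<^sub>v n)) * xmon g + R \<and>
    (\<forall>k\<in>Poly_Mapping.keys R. \<exists>v\<in>carrier_vec n. v \<noteq> 0\<^sub>v n \<and> k = expo g + expo (B *\<^sub>v map_vec int v))"
proof (intro exI conjI ballI)
  let ?t = "\<lambda>v. Poly_Mapping.single (expo g + expo (B *\<^sub>v map_vec int v)) (Poly_Mapping.lookup b v)"
  let ?R = "\<Sum>v\<in>Poly_Mapping.keys b - {0\<^sub>v n}. ?t v"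
  have "B *\<^sub>v map_vec int (0\<^sub>v n) = 0\<^sub>v (dim_row B)"
    by (intro eq_vecI) (auto simp: scalar_prod_def)
  moreover have "expo (0\<^sub>v k) = 0" for k
    by (intro poly_mapping_eqI) (simp add: lookup_expo)
  ultimately have t0: "?t (0\<^sub>v n) = scal (Poly_Mapping.lookup b (0\<^sub>v n)) * xmon g"
    by (simp add: scal_def xmon_def mult_single)
  have "F_element 1 B g b = (\<Sum>v\<in>Poly_Mapping.keys b. ?t v)"
    by (simp add: F_element_relabel_shifted relabel_def)
  also have "\<dots> = ?t (0\<^sub>v n) + ?R"
  \<comment> \<open>If 0 is not in the support, its coefficient is 0 and the split-off term
    vanishes.\<close>
  proof (cases "0\<^sub>v n \<in> Poly_Mapping.keys b")
    case True
    show ?thesis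
      by (rule sum.remove[OF finite_keys True])
  qed (simp add: in_keys_iff)
  finally show "F_element 1 B g b = scal (Poly_Mapping.lookup b (0\<^sub>v n)) * xmon g + ?R"
    using t0 by simp
  fix k assume "k \<in> Poly_Mapping.keys ?R"
  then have "k \<in> (\<Union>v\<in>Poly_Mapping.keys b - {0\<^sub>v n}. Poly_Mapping.keys (?t v))"
    by (rule subsetD[OF keys_sum])
  then show "\<exists>v\<in>carrier_vec n. v \<noteq> 0\<^sub>v n \<and> k = expo g + expo (B *\<^sub>v map_vec int v)"
    using b by (auto split: if_splits)
qed

text \<open>Besides bounding supports, membership of y in \<open>cone n B x\<close> serves as the
  order relation x <= y.\<close>

definition cone :: "nat \<Rightarrow> int mat \<Rightarrow> (nat \<Rightarrow>\<^sub>0 int) \<Rightarrow> (nat \<Rightarrow>\<^sub>0 int) set"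
  where "cone n B x = {x + expo (B *\<^sub>v map_vec int v) |v. v \<in> carrier_vec n}"

text \<open>Everything below an exponent outside the cone is outside too, by transitivity. A minimal
  such exponent therefore receives nothing from the non-leading terms, and its nonzero coefficient
  in the leading part contradicts \<open>supp\<close>.\<close>

lemma leading_exponents:
  assumes B: "B \<in> carrier_mat m n" and r: "full_rank m n B"
    and b: "\<And>j. j \<in> {3..s} \<Longrightarrow> Poly_Mapping.keys (b j) \<subseteq> carrier_vec n"
    and supp: "Poly_Mapping.keys (\<Sum>j = 3..s. c j * F_element 1 B (g j) (b j)) \<subseteq> cone n B x0"
    and survive: "\<And>j a. j \<in> {3..s} \<Longrightarrow> a \<in> Poly_Mapping.keys (c j) \<Longrightarrow>
      expo (g j) + a \<in> Poly_Mapping.keys (leading_part n s c g b)"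
    and j: "j \<in> {3..s}" and a: "a \<in> Poly_Mapping.keys (c j)"
  shows "expo (g j) + a \<in> cone n B x0"
proof (rule ccontr)
  assume bad: "expo (g j) + a \<notin> cone n B x0"
  have Bv: "B *\<^sub>v map_vec int v \<in> carrier_vec m" for v
    using B by (intro carrier_vecI) auto
  have B_add: "expo (B *\<^sub>v map_vec int (v + w)) = expo (B *\<^sub>v map_vec int v) + expo (B *\<^sub>v map_vec int w)"
    if "v \<in> carrier_vec n" "w \<in> carrier_vec n" for v w
  proof -
    have "map_vec int (v + w) = map_vec int v + map_vec int w"
      using that by auto
    then show ?thesis
      using that B by (simp add: mult_add_distrib_mat_vec[OF B] expo_add[OF Bv Bv])
  qed
  note B_inj = expo_mult_mat_vec_injective[OF B r]
  have B0: "v = 0\<^sub>v n" if "v \<in> carrier_vec n" "expo (B *\<^sub>v map_vec int v) = 0" for v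
  proof -
    \<comment> \<open>With B v = 0, the vectors v + v and v have the same image, so injectivity
      applies.\<close>
    have vv: "v + v = v"
      using that by (intro B_inj) (auto simp: B_add)
    show ?thesis
    proof (intro eq_vecI)
      fix i assume "i < dim_vec (0\<^sub>v n :: nat vec)"
      then show "v $ i = 0\<^sub>v n $ i"
        using arg_cong[OF vv, of "\<lambda>v. v $ i"] that by simp
    qed (use that in auto)
  qed
  define less where "less x y \<longleftrightarrow> y \<in> cone n B x \<and> x \<noteq> y" for x y
  have trans: "z \<in> cone n B x" if xy: "y \<in> cone n B x" and yz: "z \<in> cone n B y" for x y z
  proof -
    obtain v w where "v \<in> carrier_vec n" "w \<in> carrier_vec n"
        "y = x + expo (B *\<^sub>v map_vec int v)" "z = y + expo (B *\<^sub>v map_vec int w)"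
      using xy yz unfolding cone_def by blast
    then have "z = x + expo (B *\<^sub>v map_vec int (v + w))" "v + w \<in> carrier_vec n"
      by (auto simp: B_add add.assoc)
    then show ?thesis
      by (auto simp: cone_def)
  qed
  \<comment> \<open>Going up by v and back by w gives B (v + w) = 0, hence v + w = 0. Natural
    entries then force v = 0.\<close>
  have antisym: "x = y" if xy: "y \<in> cone n B x" and yx: "x \<in> cone n B y" for x y
  proof -
    obtain v w where v: "v \<in> carrier_vec n" "w \<in> carrier_vec n"
        "y = x + expo (B *\<^sub>v map_vec int v)" "x = y + expo (B *\<^sub>v map_vec int w)"
      using xy yx unfolding cone_def by blast
    then have "expo (B *\<^sub>v map_vec int (v + w)) = 0"
      by (simp add: B_add add.assoc) (simp add: add.commute)
    then have vw: "v + w = 0\<^sub>v n"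
      using v by (intro B0) auto
    have "v = 0\<^sub>v n"
    proof (intro eq_vecI)
      fix i assume "i < dim_vec (0\<^sub>v n :: nat vec)"
      then show "v $ i = 0\<^sub>v n $ i"
        using arg_cong[OF vw, of "\<lambda>v. v $ i"] v by simp
    qed (use v in auto)
    \<comment> \<open>As v = v + v = 0, the exponent equals its own double.\<close>
    then have "expo (B *\<^sub>v map_vec int v) = 0"
      using B_add[of v v] v(1) by simp
    then show ?thesis
      using v(3) by simp
  qed
  have "asymp less"
    using antisym by (auto simp: less_def asymp_on_def)
  have "transp less"
    using antisym trans by (auto simp: less_def transp_def)
  \<comment> \<open>The candidates for leading exponents, before any cancellation between different
    j.\<close>
  define S where "S = (\<Union>j\<in>{3..s}. (\<lambda>a. expo (g j) + a) ` Poly_Mapping.keys (c j))"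
  have "expo (g j) + a \<in> S"
    unfolding S_def using j a by blast
  then have ne: "S - cone n B x0 \<noteq> {}"
    using bad by blast
  have fin: "finite (S - cone n B x0)"
    by (simp add: S_def)
  obtain x where "x \<in> S - cone n B x0" and min: "\<And>y. y \<in> S - cone n B x0 \<Longrightarrow> y \<noteq> x \<Longrightarrow> \<not> less y x"
    using Finite_Set.bex_min_element[OF fin asymp_on_subset[OF \<open>asymp less\<close> subset_UNIV]
        transp_on_subset[OF \<open>transp less\<close> subset_UNIV] ne] by blast
  then have x: "x \<in> S" "x \<notin> cone n B x0"
    by auto
  have "\<forall>i\<in>{3..s}. \<exists>R. F_element 1 B (g i) (b i) = scal (Poly_Mapping.lookup (b i) (0\<^sub>v n)) * xmon (g i) + R \<and>
      (\<forall>k\<in>Poly_Mapping.keys R. \<exists>v\<in>carrier_vec n. v \<noteq> 0\<^sub>v n \<and> k = expo (g i) + expo (B *\<^sub>v map_vec int v))"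
    using F_element_split b by blast
  from bchoice[OF this] obtain R where R: "\<And>i. i \<in> {3..s} \<Longrightarrow>
        F_element 1 B (g i) (b i) = scal (Poly_Mapping.lookup (b i) (0\<^sub>v n)) * xmon (g i) + R i"
      "\<And>i k. i \<in> {3..s} \<Longrightarrow> k \<in> Poly_Mapping.keys (R i) \<Longrightarrow>
        \<exists>v\<in>carrier_vec n. v \<noteq> 0\<^sub>v n \<and> k = expo (g i) + expo (B *\<^sub>v map_vec int v)"
    by blast
  \<comment> \<open>A contribution at x would come from some y in \<open>S\<close> strictly below x
    and still outside the cone, against minimality.\<close>
  have "Poly_Mapping.lookup (c i * R i) x = 0" if i: "i \<in> {3..s}" for i
  proof (rule ccontr)
    assume "Poly_Mapping.lookup (c i * R i) x \<noteq> 0"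
    then have "x \<in> Poly_Mapping.keys (c i * R i)"
      by (simp add: in_keys_iff)
    then obtain a k where ak: "a \<in> Poly_Mapping.keys (c i)" "k \<in> Poly_Mapping.keys (R i)" "x = a + k"
      using keys_mult by blast
    then obtain v where v: "v \<in> carrier_vec n" "v \<noteq> 0\<^sub>v n" "k = expo (g i) + expo (B *\<^sub>v map_vec int v)"
      using R(2)[OF i] by blast
    define y where "y = expo (g i) + a"
    have xy: "x = y + expo (B *\<^sub>v map_vec int v)"
      using ak v by (simp add: y_def add_ac)
    then have "x \<in> cone n B y" "x \<noteq> y"
      using v B0 by (auto simp: cone_def)
    moreover have "y \<in> S"
      using i ak by (auto simp: S_def y_def)
    moreover have "y \<notin> cone n B x0"
      using trans[OF _ \<open>x \<in> cone n B y\<close>] x by blast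
    ultimately show False
      using min[of y] by (auto simp: less_def)
  qed
  moreover have "(\<Sum>i = 3..s. c i * F_element 1 B (g i) (b i)) = leading_part n s c g b + (\<Sum>i = 3..s. c i * R i)"
    by (simp add: leading_part_def R(1) distrib_left sum.distrib)
  ultimately have "Poly_Mapping.lookup (\<Sum>i = 3..s. c i * F_element 1 B (g i) (b i)) x
      = Poly_Mapping.lookup (leading_part n s c g b) x"
    by (simp add: lookup_add lookup_sum)
  moreover have "x \<in> Poly_Mapping.keys (leading_part n s c g b)"
    using x survive by (auto simp: S_def)
  ultimately show False
    using subsetD[OF supp, of x] x(2) by (simp add: in_keys_iff)
qed

section \<open>Transfer of the product identity to the second torus\<close>

theorem theorem9p1p2:
  fixes n m1 m2 s :: nat
    and B1 B2 L1 L2 D1 D2 :: "int mat"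
    and \<delta> :: int
    and g1 g2 :: "nat \<Rightarrow> int vec"
    and b :: "nat \<Rightarrow> nat vec \<Rightarrow>\<^sub>0 laurent"
    and c1 :: "nat \<Rightarrow> xlaurent"
  assumes "0 < n" "n \<le> m1" "n \<le> m2"
    and "weakly_compatible n m1 B1 L1 D1"
    and "weakly_compatible n m2 B2 L2 D2"
    and common_principal_part: "\<forall>i<n. \<forall>k<n. B1 $$ (i, k) = B2 $$ (i, k)"
    and "D2 = \<delta> \<cdot>\<^sub>m D1"
    and "3 \<le> s"
    and "\<forall>j\<in>{1..s}. g1 j \<in> carrier_vec m1"
    and "\<forall>j\<in>{1..s}. g2 j \<in> carrier_vec m2"
    and "\<forall>j\<in>{1..s}. vec_first (g1 j) n = vec_first (g2 j) n"
    and "\<forall>j\<in>{1..s}. Poly_Mapping.keys (b j) \<subseteq> carrier_vec n"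
    and "full_rank m1 n B1"
    and "\<forall>j\<in>{3..s}. Poly_Mapping.lookup (b j) (0\<^sub>v n) \<noteq> 0"
    and "\<forall>j\<in>{3..s}. c1 j \<in> frozen_ring n m1"
    and "scal (qhalf (- skew_form L1 (g1 1) (g1 2)))
           * twisted_mult L1 (F_element 1 B1 (g1 1) (b 1)) (F_element 1 B1 (g1 2) (b 2))
         = (\<Sum>j = 3..s. subst_coeffs 1 (c1 j) * F_element 1 B1 (g1 j) (b j))"
    and constant_term_occurs: "\<forall>j\<in>{3..s}. Poly_Mapping.lookup (c1 j) 0 \<noteq> 0"
    and leading_terms_survive:
      "\<forall>j\<in>{3..s}. \<forall>a\<in>Poly_Mapping.keys (c1 j). expo (g1 j) + a \<in> Poly_Mapping.keys (leading_part n s c1 g1 b)"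
    and frozen_monomials_agree:
      "\<forall>j\<in>{3..s}. \<forall>w\<in>carrier_vec n.
         expo (B1 *\<^sub>v w) \<in> Poly_Mapping.keys (c1 j) \<longrightarrow> expo (B2 *\<^sub>v w) = expo (B1 *\<^sub>v w)"
  shows "\<exists>u c2.
      (\<forall>j\<in>{3..s}.
         u j \<in> carrier_vec n \<and> g1 j = g1 1 + g1 2 + B1 *\<^sub>v map_vec int (u j) \<and>
         (\<forall>u'\<in>carrier_vec n. g1 j = g1 1 + g1 2 + B1 *\<^sub>v map_vec int u' \<longrightarrow> u' = u j)) \<and>
      (\<forall>j\<in>{3..s}.
         c2 j \<in> frozen_ring n m2 \<and>
         subst_coeffs \<delta> (c2 j)
           = subst_coeffs \<delta> (c1 j) * xmon (g2 1 + g2 2 + B2 *\<^sub>v map_vec int (u j) - g2 j)) \<and>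
      scal (qhalf (- skew_form L2 (g2 1) (g2 2)))
        * twisted_mult (enlarge (max m1 m2) L2)
            (F_element \<delta> B2 (g2 1) (b 1)) (F_element \<delta> B2 (g2 2) (b 2))
      = (\<Sum>j = 3..s. subst_coeffs \<delta> (c2 j) * F_element \<delta> B2 (g2 j) (b j))"
proof -
  let ?e = "\<lambda>v. expo (map_vec int v)"
  let ?y = "relabel (\<lambda>x. x) ?e"
  \<comment> \<open>Keeps the index 1 from being rewritten to \<open>Suc 0\<close>, so that facts
    about \<open>g1 1\<close> and \<open>b 1\<close> still match.\<close>
  note One_nat_def [simp del]
  note n = \<open>n \<le> m1\<close> \<open>n \<le> m2\<close>
  note g1 = assms(9)[rule_format] and g2 = assms(10)[rule_format]
  note b = assms(12)[rule_format]
  have B: "B1 \<in> carrier_mat m1 n" "B2 \<in> carrier_mat m2 n" and L: "L1 \<in> carrier_mat m1 m1"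
    and D1: "D1 \<in> carrier_mat n n"
    using assms(4,5) by (auto simp: weakly_compatible_def)
  \<comment> \<open>Makes the first torus the case d = 1 of the lemmas on the twist.\<close>
  have one: "1 \<cdot>\<^sub>m D1 = D1"
    by (intro eq_matI) simp_all
  have w1: "weakly_compatible n m1 B1 L1 (1 \<cdot>\<^sub>m D1)" and w2: "weakly_compatible n m2 B2 L2 (\<delta> \<cdot>\<^sub>m D1)"
    using assms(4,5,7) by (simp_all add: one)
  have principal: "principal_part n B2 = principal_part n B1"
    using common_principal_part by (auto simp: principal_part_def)
  have j12: "1 \<in> {1..s}" "2 \<in> {1..s}" and j3: "\<And>j. j \<in> {3..s} \<Longrightarrow> j \<in> {1..s}"
    using \<open>3 \<le> s\<close> by auto
  have B1v: "B1 *\<^sub>v v \<in> carrier_vec m1" and B2v: "B2 *\<^sub>v v \<in> carrier_vec m2" for v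
    using B by (auto intro!: carrier_vecI)
  have g12: "g1 1 + g1 2 \<in> carrier_vec m1" "g2 1 + g2 2 \<in> carrier_vec m2"
    using g1 g2 j12 by auto
  define P where "P = y_product D1 (principal_part n B1) (vec_first (g1 1) n) (vec_first (g1 2) n) (b 1) (b 2)"
  have P1: "scal (qhalf (- skew_form L1 (g1 1) (g1 2)))
      * twisted_mult L1 (F_element 1 B1 (g1 1) (b 1)) (F_element 1 B1 (g1 2) (b 2))
      = xmon (g1 1 + g1 2) * relabel (subst_t 1) (lattice_map n B1) P"
    using twisted_mult_F_element[OF w1 n(1) order_refl g1[OF j12(1)] g1[OF j12(2)] b[OF j12(1)] b[OF j12(2)]]
    by (simp only: enlarge_same[OF L] P_def)
  \<comment> \<open>The same \<open>P\<close> appears, because the second compatibility matrix is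
    \<delta> times \<open>D1\<close> and the principal parts and first n coordinates agree.\<close>
  have P2: "scal (qhalf (- skew_form L2 (g2 1) (g2 2)))
      * twisted_mult (enlarge (max m1 m2) L2) (F_element \<delta> B2 (g2 1) (b 1)) (F_element \<delta> B2 (g2 2) (b 2))
      = xmon (g2 1 + g2 2) * relabel (subst_t \<delta>) (lattice_map n B2) P"
    using twisted_mult_F_element[OF w2 n(2) max.cobounded2 g2[OF j12(1)] g2[OF j12(2)] b[OF j12(1)] b[OF j12(2)]]
    by (simp only: principal P_def assms(11)[rule_format, OF j12(1)] assms(11)[rule_format, OF j12(2)])
  have keys_P: "Poly_Mapping.keys P \<subseteq> ?e ` carrier_vec n"
    unfolding P_def by (rule keys_y_product[OF b[OF j12(1)] b[OF j12(2)]])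
  have supp: "Poly_Mapping.keys (\<Sum>j = 3..s. c1 j * F_element 1 B1 (g1 j) (b j)) \<subseteq> cone n B1 (expo (g1 1 + g1 2))"
  proof -
    have "(\<Sum>j = 3..s. c1 j * F_element 1 B1 (g1 j) (b j))
        = xmon (g1 1 + g1 2) * relabel (subst_t 1) (lattice_map n B1) P"
      using assms(16) P1 by simp
    also have "Poly_Mapping.keys \<dots> \<subseteq> cone n B1 (expo (g1 1 + g1 2))"
    proof (rule keys_mult_subset)
      show "Poly_Mapping.keys (xmon (g1 1 + g1 2)) \<subseteq> {expo (g1 1 + g1 2)}"
        by (simp add: xmon_def)
      show "Poly_Mapping.keys (relabel (subst_t 1) (lattice_map n B1) P) \<subseteq> lattice_map n B1 ` ?e ` carrier_vec n"
        by (rule order_trans[OF keys_relabel image_mono[OF keys_P]])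
      fix x y
      assume "x \<in> {expo (g1 1 + g1 2)}" and "y \<in> lattice_map n B1 ` ?e ` carrier_vec n"
      then show "x + y \<in> cone n B1 (expo (g1 1 + g1 2))"
        by (auto simp: cone_def lattice_map_expo)
    qed
    finally show ?thesis .
  qed
  have lead: "expo (g1 j) + a \<in> cone n B1 (expo (g1 1 + g1 2))"
    if "j \<in> {3..s}" "a \<in> Poly_Mapping.keys (c1 j)" for j a
    using leading_exponents[OF B(1) assms(13) b[OF j3] supp leading_terms_survive[rule_format] that] .
  have "\<exists>u. u \<in> carrier_vec n \<and> g1 j = g1 1 + g1 2 + B1 *\<^sub>v map_vec int u" if j: "j \<in> {3..s}" for j
  proof -
    \<comment> \<open>The identity shows only the products x^a x^(g_j) with x^a in c_j. The constant
      term makes g_j itself one of these exponents.\<close>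
    have "0 \<in> Poly_Mapping.keys (c1 j)"
      using constant_term_occurs j by (simp add: in_keys_iff)
    then obtain u where u: "u \<in> carrier_vec n" "expo (g1 j) = expo (g1 1 + g1 2) + expo (B1 *\<^sub>v map_vec int u)"
      using lead[OF j, of 0] by (auto simp: cone_def)
    then have "expo (g1 j) = expo (g1 1 + g1 2 + B1 *\<^sub>v map_vec int u)"
      by (simp add: expo_add[OF g12(1) B1v])
    then have "g1 j = g1 1 + g1 2 + B1 *\<^sub>v map_vec int u"
      using expo_inject[OF g1[OF j3[OF j]] add_carrier_vec[OF g12(1) B1v]] by simp
    then show ?thesis
      using u by blast
  qed
  then obtain u where u: "\<And>j. j \<in> {3..s} \<Longrightarrow> u j \<in> carrier_vec n"
      "\<And>j. j \<in> {3..s} \<Longrightarrow> g1 j = g1 1 + g1 2 + B1 *\<^sub>v map_vec int (u j)"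
    by metis
  have u_unique: "u' = u j"
    if j: "j \<in> {3..s}" and u': "u' \<in> carrier_vec n" "g1 j = g1 1 + g1 2 + B1 *\<^sub>v map_vec int u'" for j u'
  proof -
    have "expo (g1 1 + g1 2) + expo (B1 *\<^sub>v map_vec int u') = expo (g1 1 + g1 2) + expo (B1 *\<^sub>v map_vec int (u j))"
      using u(2)[OF j] u'(2) by (simp only: expo_add[OF g12(1) B1v, symmetric])
    then show ?thesis
      using expo_mult_mat_vec_injective[OF B(1) assms(13) u'(1) u(1)[OF j]] by simp
  qed
  \<comment> \<open>Exponents from Z^n instead of N^n: the monomials of c_j correspond to
    differences of natural vectors.\<close>
  let ?E = "expo ` (carrier_vec n :: int vec set)"
  have E_add: "x + y \<in> ?E" if "x \<in> ?E" "y \<in> ?E" for x y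
    using that by (force simp: expo_add[symmetric])
  have E_nat: "?e ` carrier_vec n \<subseteq> ?E"
    by auto
  \<comment> \<open>A left inverse of the exponent map of B1 on \<open>?E\<close>. Its arbitrary
    values off the image do no harm: it is evaluated only on the image, where \<open>frozen\<close>
    places the monomials of c_j.\<close>
  define \<rho> where "\<rho> = inv_into ?E (lattice_map n B1)"
  have \<rho>: "\<rho> (lattice_map n B1 x) = x" if "x \<in> ?E" for x
    unfolding \<rho>_def by (rule inv_into_f_f[OF inj_on_lattice_map[OF B(1) assms(13)] that])
  have frozen: "\<rho> a \<in> ?E \<and> lattice_map n B1 (\<rho> a) = a \<and> lattice_map n B2 (\<rho> a) = a"
    if j: "j \<in> {3..s}" and a: "a \<in> Poly_Mapping.keys (c1 j)" for j a
  proof -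
    obtain v where v: "v \<in> carrier_vec n" "expo (g1 j) + a = expo (g1 1 + g1 2) + expo (B1 *\<^sub>v map_vec int v)"
      using lead[OF j a] by (auto simp: cone_def)
    \<comment> \<open>Both g_j + a and g_j lie in g_1 + g_2 + B1 N^n, so a = B1 w for the difference
      w. By \<open>frozen_monomials_agree\<close>, B2 sends w to the same exponent.\<close>
    define w where "w = map_vec int v - map_vec int (u j)"
    have w: "w \<in> carrier_vec n"
      using v u(1)[OF j] by (simp add: w_def)
    have "B1 *\<^sub>v w = B1 *\<^sub>v map_vec int v - B1 *\<^sub>v map_vec int (u j)"
      unfolding w_def using v u(1)[OF j] by (intro mult_minus_distrib_mat_vec[OF B(1)]) auto
    moreover have "expo (g1 j) = expo (g1 1 + g1 2) + expo (B1 *\<^sub>v map_vec int (u j))"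
      using u(2)[OF j] by (simp only: expo_add[OF g12(1) B1v, symmetric])
    ultimately have aw: "a = expo (B1 *\<^sub>v w)"
      using v(2) by (simp add: expo_diff[OF B1v B1v] algebra_simps)
    then have "expo (B2 *\<^sub>v w) = a"
      using frozen_monomials_agree[rule_format, OF j w] a by simp
    moreover have "\<rho> a = expo w"
      using \<rho>[of "expo w"] w by (simp add: aw lattice_map_expo)
    ultimately show ?thesis
      using w aw by (simp add: lattice_map_expo)
  qed
  \<comment> \<open>c_j written as a Laurent polynomial in y; relabelling it by either matrix
    recovers c_j(q^(d/2)).\<close>
  define C where "C j = relabel (\<lambda>x. x) \<rho> (c1 j)" for j
  have C: "relabel (subst_t d) (lattice_map n B1) (C j) = subst_coeffs d (c1 j)"
    "relabel (subst_t d) (lattice_map n B2) (C j) = subst_coeffs d (c1 j)" if "j \<in> {3..s}" for j d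
    unfolding C_def relabel_relabel[OF additive_subst_t] subst_coeffs_relabel
    using frozen[OF that] by (auto intro!: relabel_cong)
  \<comment> \<open>The right-hand side divided by x^(g_1 + g_2), as a polynomial in y: each M_j
    turns into y^(u_j) F_j.\<close>
  define Q where "Q = (\<Sum>j = 3..s. C j * (Poly_Mapping.single (?e (u j)) 1 * ?y (b j)))"
  have keys_Q: "Poly_Mapping.keys Q \<subseteq> ?E"
    unfolding Q_def
  proof (rule keys_sum_subset)
    fix j assume j: "j \<in> {3..s}"
    have "Poly_Mapping.keys (C j) \<subseteq> ?E"
      unfolding C_def by (rule order_trans[OF keys_relabel]) (use frozen[OF j] in auto)
    moreover have "Poly_Mapping.keys (Poly_Mapping.single (?e (u j)) 1) \<subseteq> ?E"
      using u(1)[OF j] by auto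
    moreover have "Poly_Mapping.keys (?y (b j)) \<subseteq> ?E"
      using b[OF j3[OF j]] by (intro order_trans[OF keys_relabel]) auto
    ultimately show "Poly_Mapping.keys (C j * (Poly_Mapping.single (?e (u j)) 1 * ?y (b j))) \<subseteq> ?E"
      by (intro keys_mult_subset[of _ ?E _ ?E] E_add)
  qed
  have relabel_Q: "relabel (subst_t d) (lattice_map n B') Q = (\<Sum>j = 3..s. relabel (subst_t d) (lattice_map n B') (C j)
      * (xmon (B' *\<^sub>v map_vec int (u j)) * relabel (subst_t d) (lattice_map n B') (?y (b j))))"
    if B': "B' \<in> carrier_mat m n" for d B' m
  proof -
    have "lattice_map n B' (?e (u j)) = expo (B' *\<^sub>v map_vec int (u j))" if "j \<in> {3..s}" for j
      using u(1)[OF that] by (intro lattice_map_expo) simp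
    then show ?thesis
      unfolding Q_def additive.sum[OF additive_relabel[OF additive_subst_t]]
      by (intro sum.cong[OF refl]) (simp add: relabel_lattice_map_mult[OF B'] xmon_def)
  qed
  have "xmon (g1 1 + g1 2) * relabel (subst_t 1) (lattice_map n B1) P
      = (\<Sum>j = 3..s. subst_coeffs 1 (c1 j) * F_element 1 B1 (g1 j) (b j))"
    using assms(16) P1 by (simp only:)
  also have "\<dots> = xmon (g1 1 + g1 2) * relabel (subst_t 1) (lattice_map n B1) Q"
    unfolding relabel_Q[OF B(1)] sum_distrib_left
  proof (intro sum.cong[OF refl])
    fix j assume j: "j \<in> {3..s}"
    have "xmon (g1 j) = xmon (g1 1 + g1 2) * xmon (B1 *\<^sub>v map_vec int (u j))"
      using u(2)[OF j] by (simp only: xmon_add[OF g12(1) B1v, symmetric])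
    then show "subst_coeffs 1 (c1 j) * F_element 1 B1 (g1 j) (b j) = xmon (g1 1 + g1 2)
        * (relabel (subst_t 1) (lattice_map n B1) (C j)
          * (xmon (B1 *\<^sub>v map_vec int (u j)) * relabel (subst_t 1) (lattice_map n B1) (?y (b j))))"
      by (simp only: C(1)[OF j] F_element_lattice_map[OF b[OF j3[OF j]]] mult_ac)
  qed
  finally have eq: "relabel (subst_t 1) (lattice_map n B1) P = relabel (subst_t 1) (lattice_map n B1) Q"
    by (simp only: xmon_cancel)
  \<comment> \<open>For d = 1 coefficients are unchanged and \<rho> undoes the exponent map, so the
    identity in the first torus can be lifted to P = Q.\<close>
  have retract: "relabel (\<lambda>x. x) \<rho> (relabel (subst_t 1) (lattice_map n B1) R) = R"
    if "Poly_Mapping.keys R \<subseteq> ?E" for R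
    unfolding relabel_relabel[OF additive_id] using that \<rho> by (intro relabel_same) auto
  have PQ: "P = Q"
    using retract[of P] retract[OF keys_Q] keys_P E_nat eq by (metis order_trans)
  define h where "h j = g2 1 + g2 2 + B2 *\<^sub>v map_vec int (u j) - g2 j" for j
  have h: "h j \<in> carrier_vec m2" if "j \<in> {3..s}" for j
    unfolding h_def by (rule minus_carrier_vec[OF add_carrier_vec[OF g12(2) B2v] g2[OF j3[OF that]]])
  have xmon_h: "xmon (h j) * xmon (g2 j) = xmon (g2 1 + g2 2) * xmon (B2 *\<^sub>v map_vec int (u j))"
    if j: "j \<in> {3..s}" for j
    by (simp add: xmon_def mult_single h_def expo_diff[OF add_carrier_vec[OF g12(2) B2v] g2[OF j3[OF j]]]
        expo_add[OF g12(2) B2v])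
  \<comment> \<open>In the first n coordinates, h_j agrees with g_1 + g_2 + B1 u_j - g_j formed in
    the first torus, which is 0.\<close>
  have h_frozen: "h j $ i = 0" if j: "j \<in> {3..s}" and i: "i < n" for j i
  proof -
    have agree: "g1 k $ i = g2 k $ i" if "k \<in> {1..s}" for k
      using arg_cong[OF assms(11)[rule_format, OF that], of "\<lambda>v. v $ i"] i by (simp add: vec_first_def)
    have uj: "map_vec int (u j) \<in> carrier_vec n"
      using u(1)[OF j] by simp
    have "vec_first (B1 *\<^sub>v map_vec int (u j)) n = vec_first (B2 *\<^sub>v map_vec int (u j)) n"
      by (simp only: vec_first_mult_mat_vec[OF B(1) n(1) uj] vec_first_mult_mat_vec[OF B(2) n(2) uj] principal)
    then have "(B1 *\<^sub>v map_vec int (u j)) $ i = (B2 *\<^sub>v map_vec int (u j)) $ i"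
      using i by (metis index_vec vec_first_def)
    moreover have "g1 j $ i = g1 1 $ i + g1 2 $ i + (B1 *\<^sub>v map_vec int (u j)) $ i"
      using arg_cong[OF u(2)[OF j], of "\<lambda>v. v $ i"] i n g1[OF j12(1)] g1[OF j12(2)] B by simp
    ultimately show ?thesis
      using i n g2[OF j12(1)] g2[OF j12(2)] g2[OF j3[OF j]] B agree[OF j12(1)] agree[OF j12(2)] agree[OF j3[OF j]]
      by (simp add: h_def)
  qed
  define c2 where "c2 j = c1 j * xmon (h j)" for j
  have c2_frozen: "c2 j \<in> frozen_ring n m2" if j: "j \<in> {3..s}" for j
  proof -
    let ?S = "{a :: nat \<Rightarrow>\<^sub>0 int. Poly_Mapping.keys a \<subseteq> {n..<m2}}"
    have "Poly_Mapping.keys (c2 j) \<subseteq> ?S"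
      unfolding c2_def
    proof (rule keys_mult_subset[of _ ?S _ ?S])
      show "Poly_Mapping.keys (c1 j) \<subseteq> ?S"
      proof clarify
        fix a i assume a: "a \<in> Poly_Mapping.keys (c1 j)" and i: "i \<in> Poly_Mapping.keys a"
        have "n \<le> i"
          using assms(15) j a i by (force simp: frozen_ring_def)
        \<comment> \<open>The hypothesis on c_j bounds i only by m1, and m2 may be smaller. The
          bound by m2 holds because the exponent is also an image under B2, which has m2
          rows.\<close>
        moreover have "i < m2"
        proof (rule ccontr)
          assume "\<not> i < m2"
          then have "Poly_Mapping.lookup (lattice_map n B2 (\<rho> a)) i = 0"
            using B by (simp add: lattice_map_def lookup_expo)
          then show False
            using frozen[OF j a] i by (simp add: in_keys_iff)
        qed
        ultimately show "i \<in> {n..<m2}"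
          by simp
      qed
      show "Poly_Mapping.keys (xmon (h j)) \<subseteq> ?S"
        using h[OF j] h_frozen[OF j]
        by (auto simp: xmon_def in_keys_iff lookup_expo not_less[symmetric] split: if_splits)
      show "x + y \<in> ?S" if "x \<in> ?S" "y \<in> ?S" for x y
        using that Poly_Mapping.keys_add[of x y] by blast
    qed
    then show ?thesis
      by (auto simp: frozen_ring_def)
  qed
  have c2_subst: "subst_coeffs \<delta> (c2 j) = subst_coeffs \<delta> (c1 j) * xmon (h j)" for j
    by (simp add: c2_def subst_coeffs_mult)
  have "xmon (g2 1 + g2 2) * relabel (subst_t \<delta>) (lattice_map n B2) P
      = (\<Sum>j = 3..s. subst_coeffs \<delta> (c2 j) * F_element \<delta> B2 (g2 j) (b j))"
    unfolding PQ relabel_Q[OF B(2)] sum_distrib_left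
  proof (intro sum.cong[OF refl])
    fix j assume j: "j \<in> {3..s}"
    let ?F = "relabel (subst_t \<delta>) (lattice_map n B2) (?y (b j))"
    have "xmon (g2 1 + g2 2) * (subst_coeffs \<delta> (c1 j) * (xmon (B2 *\<^sub>v map_vec int (u j)) * ?F))
        = subst_coeffs \<delta> (c1 j) * (xmon (g2 1 + g2 2) * xmon (B2 *\<^sub>v map_vec int (u j))) * ?F"
      by (simp only: mult_ac)
    \<comment> \<open>The monomial x^(h_j) absorbs the discrepancy between g_j and g_1 + g_2 + B2
      u_j in the second torus.\<close>
    also have "\<dots> = subst_coeffs \<delta> (c1 j) * (xmon (h j) * xmon (g2 j)) * ?F"
      by (simp only: xmon_h[OF j])
    finally show "xmon (g2 1 + g2 2) * (relabel (subst_t \<delta>) (lattice_map n B2) (C j)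
          * (xmon (B2 *\<^sub>v map_vec int (u j)) * ?F))
        = subst_coeffs \<delta> (c2 j) * F_element \<delta> B2 (g2 j) (b j)"
      by (simp only: C(2)[OF j] c2_subst F_element_lattice_map[OF b[OF j3[OF j]]] mult_ac)
  qed
  then show ?thesis
    using u u_unique c2_frozen c2_subst P2 unfolding h_def
    by (intro exI[of _ u] exI[of _ c2] conjI ballI impI) auto
qed

end
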